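(* Let $M(z)$ be a nonsingular meromorphic matrix. Then the following are equivalent: (1) $M(z)$ is a meromorphic fundamental matrix for some $p$-theta $q$-difference equation; (2) $M(z)^t$ is a meromorphic fundamental matrix for some $q$-theta $p$-difference equation; (1') $M(z)^{-t}$ is a meromorphic fundamental matrix for some $p$-theta $q$-difference equation; (2') $M(z)^{-1}$ is a meromorphic fundamental matrix for some $q$-theta $p$-difference equation. The corresponding statements with "some" replaced by "a unique" are also equivalent to these. Furthermore, if the equivalent conditions (1), (2), (1'), (2') hold, then the multipliers of the difference equations in (1) and (2) agree, and they are inverse to the multipliers of the difference equations in (1') and (2').
   Context: $p,q$ are fixed nonzero complex numbers with $|p|,|q|<1$ and $p^{\mathbb Z}\cap q^{\mathbb Z}=\{1\}$. $\mathbb C^*=\mathbb C\setminus\{0\}$. A nonsingular meromorphic matrix is a square matrix whose entries are meromorphic functions on $\mathbb C^*$ and whose determinant is not identically $0$. $M^t$ is the transpose and $M^{-t}$ the inverse of the transpose. A $p$-theta $q$-difference equation of multiplier $\mu(z)=\alpha z^k$ ($\alpha\in\mathbb C^*$, $k\in\mathbb Z$) is an equation $v(qz)=A(z)v(z)$, where $A(z)$ (the shift matrix) is a nonsingular meromorphic matrix with $A(pz)=\mu(z)A(z)$. A meromorphic fundamental matrix for it is a nonsingular meromorphic matrix $M(z)$ with $M(qz)=A(z)M(z)$. A $q$-theta $p$-difference equation and its fundamental matrices are defined by exchanging $p$ and $q$: $w(pz)=C(z)w(z)$ with $C(qz)=\mu(z)C(z)$, and fundamental matrix $N$ satisfying $N(pz)=C(z)N(z)$.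 *)

theory Defs
  imports "HOL-Complex_Analysis.Complex_Analysis"
begin

text \<open>
  A meromorphic function on the punctured plane is represented by a total function that is
  \<^const>\<open>meromorphic_on\<close> the set \<open>- {0}\<close>. The values of such a representative at its poles, and
  at isolated points generally, carry no information, so every identity between meromorphic
  functions below is required only off a set that is sparse in \<open>- {0}\<close>.
\<close>

definition nonsingular_meromorphic_matrix :: "(complex \<Rightarrow> complex^'n^'n) \<Rightarrow> bool" where
  "nonsingular_meromorphic_matrix M \<longleftrightarrow>
     (\<forall>i j. (\<lambda>z. M z $ i $ j) meromorphic_on (- {0})) \<and>
     \<not> (\<forall>\<^sub>\<approx>z\<in>- {0}. det (M z) = 0)"

definition meromorphic_matrix_eq ::
    "(complex \<Rightarrow> complex^'n^'n) \<Rightarrow> (complex \<Rightarrow> complex^'n^'n) \<Rightarrow> bool" where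
  "meromorphic_matrix_eq A B \<longleftrightarrow> (\<forall>\<^sub>\<approx>z\<in>- {0}. A z = B z)"

definition theta_multiplier :: "(complex \<Rightarrow> complex) \<Rightarrow> bool" where
  "theta_multiplier \<mu> \<longleftrightarrow> (\<exists>\<alpha> (k::int). \<alpha> \<noteq> 0 \<and> \<mu> = (\<lambda>z. \<alpha> * z powi k))"

text \<open>
  A \<open>p\<close>-theta \<open>q\<close>-difference equation \<open>v(qz) = A(z) v(z)\<close> is represented by its shift matrix \<open>A\<close>;
  the predicate below is the condition on \<open>A\<close>, which does not involve \<open>q\<close>.
\<close>

definition theta_shift_matrix ::
    "complex \<Rightarrow> (complex \<Rightarrow> complex) \<Rightarrow> (complex \<Rightarrow> complex^'n^'n) \<Rightarrow> bool" where
  "theta_shift_matrix p \<mu> A \<longleftrightarrow>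
     theta_multiplier \<mu> \<and> nonsingular_meromorphic_matrix A \<and>
     (\<forall>\<^sub>\<approx>z\<in>- {0}. A (p * z) = (\<chi> i j. \<mu> z * A z $ i $ j))"

definition fundamental_matrix ::
    "complex \<Rightarrow> (complex \<Rightarrow> complex^'n^'n) \<Rightarrow> (complex \<Rightarrow> complex^'n^'n) \<Rightarrow> bool" where
  "fundamental_matrix q A M \<longleftrightarrow>
     nonsingular_meromorphic_matrix M \<and> (\<forall>\<^sub>\<approx>z\<in>- {0}. M (q * z) = A z ** M z)"

text \<open>
  In the following, the first argument is the theta parameter and the second the difference
  parameter; exchanging them turns \<open>p\<close>-theta \<open>q\<close>-difference equations into
  \<open>q\<close>-theta \<open>p\<close>-difference equations.
\<close>

definition fundamental_for_theta_eq ::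
    "complex \<Rightarrow> complex \<Rightarrow> (complex \<Rightarrow> complex) \<Rightarrow> (complex \<Rightarrow> complex^'n^'n) \<Rightarrow>
     (complex \<Rightarrow> complex^'n^'n) \<Rightarrow> bool" where
  "fundamental_for_theta_eq p q \<mu> A M \<longleftrightarrow> theta_shift_matrix p \<mu> A \<and> fundamental_matrix q A M"

definition fundamental_for_some ::
    "complex \<Rightarrow> complex \<Rightarrow> (complex \<Rightarrow> complex^'n^'n) \<Rightarrow> bool" where
  "fundamental_for_some p q M \<longleftrightarrow> (\<exists>A \<mu>. fundamental_for_theta_eq p q \<mu> A M)"

definition fundamental_for_unique ::
    "complex \<Rightarrow> complex \<Rightarrow> (complex \<Rightarrow> complex^'n^'n) \<Rightarrow> bool" where
  "fundamental_for_unique p q M \<longleftrightarrow>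
     (\<exists>A. (\<exists>\<mu>. fundamental_for_theta_eq p q \<mu> A M) \<and>
          (\<forall>B. (\<exists>\<nu>. fundamental_for_theta_eq p q \<nu> B M) \<longrightarrow> meromorphic_matrix_eq B A))"

end

theory Submission
  imports Defs
begin

text \<open>
  If \<open>M(qz) = A(z) M(z)\<close> and \<open>M(pz) = M(z) N(z)\<close>, evaluating \<open>M(pqz)\<close> in two ways gives
  \<open>A(pz) M(z) N(z) = A(z) M(z) N(qz)\<close>, so that \<open>A(pz) = \<mu>(z) A(z)\<close> is equivalent to
  \<open>N(qz) = \<mu>(z) N(z)\<close>; and \<open>N\<close> is the transpose of the shift matrix of the transposed equation.
  Passing to the inverse transpose replaces \<open>A\<close> by \<open>A\<^sup>-\<^sup>t\<close> and \<open>\<mu>\<close> by \<open>1/\<mu>\<close>, and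
  \<open>M\<^sup>-\<^sup>1\<close> is the inverse transpose of the transpose. Shift matrices are unique because
  \<open>A(z) = M(qz) M(z)\<^sup>-\<^sup>1\<close>.
\<close>

unbundle no Formal_Power_Series.fps_syntax

section \<open>Matrices over a field\<close>

text \<open>\<open>matrix_inv\<close> is a choice of a two-sided inverse. For square matrices over a
  field a right inverse is also a left inverse, so such a choice exists and must be
  \<open>B\<close>. Later inverses are thus identified by checking a single product.\<close>

lemma matrix_inv_eqI:
  fixes A B :: "'a::field^'n^'n"
  assumes "A ** B = mat 1"
  shows "matrix_inv A = B"
proof -
  have "B ** A = mat 1"
    using assms by (simp add: matrix_left_right_inverse)
  hence "\<exists>C. A ** C = mat 1 \<and> C ** A = mat 1"
    using assms by blast
  hence "matrix_inv A ** A = mat 1"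
    unfolding matrix_inv_def by (metis (mono_tags, lifting) someI_ex)
  thus ?thesis
    using assms by (metis matrix_mul_assoc matrix_mul_lid matrix_mul_rid)
qed

lemma
  fixes A :: "'a::field^'n^'n"
  assumes "det A \<noteq> 0"
  shows matrix_inv_right: "A ** matrix_inv A = mat 1"
    and matrix_inv_left: "matrix_inv A ** A = mat 1"
proof -
  obtain B where "A ** B = mat 1" "B ** A = mat 1"
    using assms unfolding invertible_det_nz [symmetric] invertible_def by blast
  thus "A ** matrix_inv A = mat 1" "matrix_inv A ** A = mat 1"
    using matrix_inv_eqI by auto
qed

lemma det_matrix_inv_nonzero:
  fixes A :: "'a::field^'n^'n"
  assumes "det A \<noteq> 0"
  shows "det (matrix_inv A) \<noteq> 0"
  using arg_cong [OF matrix_inv_right [OF assms], of det] by (auto simp: det_mul)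

lemma matrix_inv_mult:
  fixes A B :: "'a::field^'n^'n"
  assumes "det A \<noteq> 0" "det B \<noteq> 0"
  shows "matrix_inv (A ** B) = matrix_inv B ** matrix_inv A"
proof (rule matrix_inv_eqI)
  have "A ** B ** (matrix_inv B ** matrix_inv A) = A ** (B ** matrix_inv B) ** matrix_inv A"
    by (simp only: matrix_mul_assoc)
  thus "A ** B ** (matrix_inv B ** matrix_inv A) = mat 1"
    using assms by (simp add: matrix_inv_right)
qed

lemma matrix_inv_transpose:
  fixes A :: "'a::field^'n^'n"
  assumes "det A \<noteq> 0"
  shows "matrix_inv (transpose A) = transpose (matrix_inv A)"
  by (rule matrix_inv_eqI) (simp add: matrix_transpose_mul [symmetric] matrix_inv_left assms)

lemma matrix_inv_matrix_inv:
  fixes A :: "'a::field^'n^'n"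
  assumes "det A \<noteq> 0"
  shows "matrix_inv (matrix_inv A) = A"
  by (rule matrix_inv_eqI) (rule matrix_inv_left [OF assms])

text \<open>Cramer's rule for \<open>A *v x = e_j\<close>, whose solution is column \<open>j\<close>
  of the inverse. The quotient of determinants is what makes the entries of the inverse visibly
  meromorphic.\<close>

lemma matrix_inv_entry:
  fixes A :: "'a::field^'n^'n"
  assumes "det A \<noteq> 0"
  shows "matrix_inv A $ k $ j =
    det (\<chi> i l. if l = k then (if i = j then 1 else 0) else A $ i $ l) / det A"
proof -
  let ?e = "\<chi> i. if i = j then 1 else 0"
  have "A *v (\<chi> i. matrix_inv A $ i $ j) = ?e"
    using matrix_inv_right [OF assms]
    by (simp add: vec_eq_iff matrix_matrix_mult_def matrix_vector_mult_def mat_def)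
  thus ?thesis
    unfolding cramer [OF assms] by (simp add: vec_eq_iff cong: if_cong)
qed

text \<open>Scaling becomes a matrix product, so that calculations with multipliers need only
  associativity and the centrality of scalar matrices.\<close>

lemma scaled_matrix_eq_mat_mult:
  fixes A :: "'a::comm_semiring_1^'n^'n"
  shows "(\<chi> i j. c * A $ i $ j) = mat c ** A"
  by (simp add: vec_eq_iff matrix_matrix_mult_def mat_def if_distrib [of "\<lambda>x. x * _"]
      cong: if_cong)

lemma mat_mult_commute:
  fixes A :: "'a::comm_semiring_1^'n^'n"
  shows "mat c ** A = A ** mat c"
  by (simp add: vec_eq_iff matrix_matrix_mult_def mat_def if_distrib [of "\<lambda>x. x * _"]
      if_distrib [of "\<lambda>x. _ * x"] mult.commute cong: if_cong)

lemma mat_mult_mat: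
  fixes c d :: "'a::comm_semiring_1"
  shows "mat c ** mat d = (mat (c * d) :: 'a^'n^'n)"
  unfolding scaled_matrix_eq_mat_mult [symmetric] by (simp add: vec_eq_iff mat_def)

lemma matrix_inv_scaled:
  fixes A :: "'a::field^'n^'n"
  assumes "c \<noteq> 0" "det A \<noteq> 0"
  shows "matrix_inv (mat c ** A) = mat (inverse c) ** matrix_inv A"
proof (rule matrix_inv_eqI)
  have "mat c ** A ** (mat (inverse c) ** matrix_inv A) =
      (mat c ** mat (inverse c)) ** (A ** matrix_inv A)"
    by (metis mat_mult_commute matrix_mul_assoc)
  thus "mat c ** A ** (mat (inverse c) ** matrix_inv A) = mat 1"
    using assms by (simp add: matrix_inv_right mat_mult_mat)
qed

section \<open>Nonsingular meromorphic matrices\<close>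

text \<open>Being cosparse in an open set is a condition on punctured neighbourhoods, and
  \<open>z \<mapsto> c * z\<close> carries those of \<open>x\<close> into those of
  \<open>c * x\<close>. This permits substituting \<open>p * z\<close> or \<open>q * z\<close> in
  identities that hold off a sparse set.\<close>

lemma eventually_cosparse_punctured_scale:
  fixes c :: complex
  assumes "\<forall>\<^sub>\<approx>z\<in>- {0}. P z" "c \<noteq> 0"
  shows "\<forall>\<^sub>\<approx>z\<in>- {0}. P (c * z)"
proof -
  have open0: "open (- {0::complex})"
    by (simp add: open_Compl)
  have "\<forall>\<^sub>F z in at x. P (c * z)" if "x \<noteq> 0" for x
  proof -
    have "\<forall>\<^sub>F w in at (c * x). P w"
      using assms that by (simp add: eventually_cosparse_open_eq [OF open0])
    moreover have "filterlim (\<lambda>z. c * z) (at (c * x)) (at x)"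
      unfolding filterlim_at
      using assms(2) by (auto intro!: tendsto_eq_intros simp: eventually_at_filter)
    ultimately show ?thesis
      by (rule eventually_compose_filterlim)
  qed
  thus ?thesis
    by (simp add: eventually_cosparse_open_eq [OF open0])
qed

lemma eventually_cosparse_nonzero: "\<forall>\<^sub>\<approx>z\<in>- {0::complex}. z \<noteq> 0"
  using eventually_in_cosparse [of "- {0::complex}" "- {0}"] by (simp add: open_Compl)

lemma meromorphic_on_punctured_scale:
  assumes "f meromorphic_on (- {0})" "c \<noteq> 0"
  shows "(\<lambda>z. f (c * z)) meromorphic_on (- {0})"
  by (rule meromorphic_on_compose [OF assms(1)]) (use assms(2) in \<open>auto intro!: analytic_intros\<close>)

lemma meromorphic_on_det:
  fixes M :: "complex \<Rightarrow> complex^'n^'n"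
  assumes "\<And>i j. (\<lambda>z. M z $ i $ j) meromorphic_on S"
  shows "(\<lambda>z. det (M z)) meromorphic_on S"
  unfolding det_def by (intro meromorphic_intros assms)

text \<open>By the identity theorem on the connected set \<open>- {0}\<close>, a determinant that
  does not vanish identically is nonzero off a sparse set. Matrices can then be inverted pointwise
  under \<open>eventually_elim\<close>.\<close>

lemma nonsingular_meromorphic_matrix_iff:
  "nonsingular_meromorphic_matrix M \<longleftrightarrow>
    (\<forall>i j. (\<lambda>z. M z $ i $ j) meromorphic_on (- {0})) \<and> (\<forall>\<^sub>\<approx>z\<in>- {0}. det (M z) \<noteq> 0)"
proof -
  have "\<not> (\<forall>\<^sub>\<approx>z\<in>- {0}. det (M z) = 0) \<longleftrightarrow> (\<forall>\<^sub>\<approx>z\<in>- {0}. det (M z) \<noteq> 0)"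
    if "\<forall>i j. (\<lambda>z. M z $ i $ j) meromorphic_on (- {0})"
  proof
    have "connected (- {0::complex})"
      by (simp add: connected_punctured_universe)
    thus "\<forall>\<^sub>\<approx>z\<in>- {0}. det (M z) \<noteq> 0" if "\<not> (\<forall>\<^sub>\<approx>z\<in>- {0}. det (M z) = 0)"
      using meromorphic_imp_constant_or_avoid [OF meromorphic_on_det, of M "- {0}" 0]
        \<open>\<forall>i j. _ i j\<close> that by (auto simp: open_Compl)
    show "\<not> (\<forall>\<^sub>\<approx>z\<in>- {0}. det (M z) = 0)" if "\<forall>\<^sub>\<approx>z\<in>- {0}. det (M z) \<noteq> 0"
    proof
      assume "\<forall>\<^sub>\<approx>z\<in>- {0}. det (M z) = 0"
      with that have "\<forall>\<^sub>\<approx>z\<in>- {0::complex}. False"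
        by eventually_elim simp
      \<comment> \<open>The cosparse filter is trivial only for the empty set, so a point of
        \<open>- {0}\<close> yields the contradiction.\<close>
      moreover have "(1::complex) \<in> - {0}"
        by simp
      ultimately show False
        by (metis cosparse_eq_bot_iff' empty_iff eventually_False)
    qed
  qed
  thus ?thesis
    unfolding nonsingular_meromorphic_matrix_def by blast
qed

lemma nonsingular_meromorphic_matrix_transpose:
  "nonsingular_meromorphic_matrix M \<Longrightarrow> nonsingular_meromorphic_matrix (\<lambda>z. transpose (M z))"
  by (simp add: nonsingular_meromorphic_matrix_iff) (simp add: transpose_def)

lemma nonsingular_meromorphic_matrix_mult:
  assumes "nonsingular_meromorphic_matrix A" "nonsingular_meromorphic_matrix B"
  shows "nonsingular_meromorphic_matrix (\<lambda>z. A z ** B z)"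
proof -
  have "\<forall>\<^sub>\<approx>z\<in>- {0}. det (A z) \<noteq> 0" "\<forall>\<^sub>\<approx>z\<in>- {0}. det (B z) \<noteq> 0"
    using assms by (auto simp: nonsingular_meromorphic_matrix_iff)
  hence "\<forall>\<^sub>\<approx>z\<in>- {0}. det (A z ** B z) \<noteq> 0"
    by eventually_elim (simp add: det_mul)
  moreover have "(\<lambda>z. (A z ** B z) $ i $ j) meromorphic_on (- {0})" for i j
    using assms unfolding matrix_matrix_mult_def nonsingular_meromorphic_matrix_iff
    by (auto intro!: meromorphic_intros)
  ultimately show ?thesis
    by (simp add: nonsingular_meromorphic_matrix_iff)
qed

lemma nonsingular_meromorphic_matrix_scale:
  assumes "nonsingular_meromorphic_matrix M" "c \<noteq> 0"
  shows "nonsingular_meromorphic_matrix (\<lambda>z. M (c * z))"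
proof -
  have "\<forall>\<^sub>\<approx>z\<in>- {0}. det (M (c * z)) \<noteq> 0"
    using assms
    by (intro eventually_cosparse_punctured_scale [where P = "\<lambda>z. det (M z) \<noteq> 0"])
      (auto simp: nonsingular_meromorphic_matrix_iff)
  moreover have "(\<lambda>z. M (c * z) $ i $ j) meromorphic_on (- {0})" for i j
    using assms
    by (intro meromorphic_on_punctured_scale) (auto simp: nonsingular_meromorphic_matrix_iff)
  ultimately show ?thesis
    by (simp add: nonsingular_meromorphic_matrix_iff)
qed

lemma nonsingular_meromorphic_matrix_inv:
  assumes "nonsingular_meromorphic_matrix M"
  shows "nonsingular_meromorphic_matrix (\<lambda>z. matrix_inv (M z))"
proof -
  have mero: "(\<lambda>z. M z $ i $ j) meromorphic_on (- {0})" for i j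
    using assms by (simp add: nonsingular_meromorphic_matrix_iff)
  have nz: "\<forall>\<^sub>\<approx>z\<in>- {0}. det (M z) \<noteq> 0"
    using assms by (simp add: nonsingular_meromorphic_matrix_iff)
  have "(\<lambda>z. matrix_inv (M z) $ k $ j) meromorphic_on (- {0})" for k j
  proof -
    let ?N = "\<lambda>z. \<chi> i l. if l = k then (if i = j then 1 else 0) else M z $ i $ l"
    have "(\<lambda>z. ?N z $ i $ l) meromorphic_on (- {0})" for i l
      by (cases "l = k"; cases "i = j") (auto intro: mero)
    hence "(\<lambda>z. det (?N z) / det (M z)) meromorphic_on (- {0})"
      by (intro meromorphic_on_divide meromorphic_on_det mero)
    \<comment> \<open>Where the determinant vanishes, \<open>matrix_inv\<close> has an unspecified
      value; meromorphy is unaffected by a change on a sparse set.\<close>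
    moreover have "\<forall>\<^sub>\<approx>z\<in>- {0}. matrix_inv (M z) $ k $ j = det (?N z) / det (M z)"
      using nz by eventually_elim (rule matrix_inv_entry)
    ultimately show ?thesis
      by (subst meromorphic_on_cong' [OF _ refl])
  qed
  moreover have "\<forall>\<^sub>\<approx>z\<in>- {0}. det (matrix_inv (M z)) \<noteq> 0"
    using nz by eventually_elim (rule det_matrix_inv_nonzero)
  ultimately show ?thesis
    by (simp add: nonsingular_meromorphic_matrix_iff)
qed

section \<open>Theta difference equations\<close>

lemma theta_multiplier_nonzero: "theta_multiplier \<mu> \<Longrightarrow> z \<noteq> 0 \<Longrightarrow> \<mu> z \<noteq> 0"
  by (auto simp: theta_multiplier_def power_int_eq_0_iff)

lemma theta_multiplier_inverse:
  assumes "theta_multiplier \<mu>"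
  shows "theta_multiplier (\<lambda>z. inverse (\<mu> z))"
proof -
  obtain \<alpha> k where "\<alpha> \<noteq> 0" "\<mu> = (\<lambda>z. \<alpha> * z powi k)"
    using assms by (auto simp: theta_multiplier_def)
  hence "inverse \<alpha> \<noteq> 0 \<and> (\<lambda>z. inverse (\<mu> z)) = (\<lambda>z. inverse \<alpha> * z powi (- k))"
    by (simp add: fun_eq_iff power_int_minus)
  thus ?thesis
    unfolding theta_multiplier_def by blast
qed

lemma isCont_theta_multiplier: "theta_multiplier \<mu> \<Longrightarrow> z \<noteq> 0 \<Longrightarrow> isCont \<mu> z"
  by (auto simp: theta_multiplier_def intro!: continuous_intros)

text \<open>Both multipliers are continuous at \<open>z\<close>, and they agree on a punctured
  neighbourhood, so uniqueness of limits gives equality at \<open>z\<close> itself.\<close>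

lemma theta_multiplier_eqI:
  assumes "theta_multiplier \<mu>" "theta_multiplier \<nu>" "\<forall>\<^sub>\<approx>z\<in>- {0}. \<mu> z = \<nu> z" "z \<noteq> 0"
  shows "\<mu> z = \<nu> z"
proof -
  have "\<forall>\<^sub>F w in at z. \<mu> w = \<nu> w"
    using assms(3,4) by (auto intro: eventually_cosparse_imp_eventually_at)
  moreover have "\<mu> \<midarrow>z\<rightarrow> \<mu> z" "\<nu> \<midarrow>z\<rightarrow> \<nu> z"
    using assms isCont_theta_multiplier by (auto simp: isCont_def)
  ultimately show ?thesis
    by (metis LIM_unique tendsto_cong)
qed

section \<open>Theta equations under transposition and inversion\<close>

lemma fundamental_for_theta_eq_iff:
  "fundamental_for_theta_eq p q \<mu> A M \<longleftrightarrow>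
    theta_multiplier \<mu> \<and> nonsingular_meromorphic_matrix A \<and>
    nonsingular_meromorphic_matrix M \<and>
    (\<forall>\<^sub>\<approx>z\<in>- {0}. A (p * z) = mat (\<mu> z) ** A z) \<and> (\<forall>\<^sub>\<approx>z\<in>- {0}. M (q * z) = A z ** M z)"
  by (auto simp: fundamental_for_theta_eq_def theta_shift_matrix_def fundamental_matrix_def
      scaled_matrix_eq_mat_mult)

lemma fundamental_for_theta_eq_cong:
  assumes "fundamental_for_theta_eq p q \<mu> A M" "nonsingular_meromorphic_matrix N"
    "\<forall>\<^sub>\<approx>z\<in>- {0}. M z = N z" "q \<noteq> 0"
  shows "fundamental_for_theta_eq p q \<mu> A N"
proof -
  have "\<forall>\<^sub>\<approx>z\<in>- {0}. M (q * z) = N (q * z)"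
    using eventually_cosparse_punctured_scale [OF assms(3,4)] .
  moreover have "\<forall>\<^sub>\<approx>z\<in>- {0}. M (q * z) = A z ** M z"
    using assms(1) by (simp add: fundamental_for_theta_eq_iff)
  ultimately have "\<forall>\<^sub>\<approx>z\<in>- {0}. N (q * z) = A z ** N z"
    using assms(3) by eventually_elim simp
  thus ?thesis
    using assms(1,2) by (simp add: fundamental_for_theta_eq_iff)
qed

text \<open>The factor \<open>N\<close> is forced by \<open>M (p * z) = M z ** N z\<close>. The same
  \<mu> is kept in the conclusion, which is what later allows the multipliers to be
  compared.\<close>

lemma fundamental_for_theta_eq_transpose:
  fixes M :: "complex \<Rightarrow> complex^'n^'n"
  assumes "fundamental_for_theta_eq p q \<mu> A M" "p \<noteq> 0" "q \<noteq> 0"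
  defines "N \<equiv> \<lambda>z. matrix_inv (M z) ** M (p * z)"
  shows "fundamental_for_theta_eq q p \<mu> (\<lambda>z. transpose (N z)) (\<lambda>z. transpose (M z))"
proof -
  have \<mu>: "theta_multiplier \<mu>"
    and A: "nonsingular_meromorphic_matrix A"
    and M: "nonsingular_meromorphic_matrix M"
    and shift: "\<forall>\<^sub>\<approx>z\<in>- {0}. A (p * z) = mat (\<mu> z) ** A z"
    and fund: "\<forall>\<^sub>\<approx>z\<in>- {0}. M (q * z) = A z ** M z"
    using assms(1) by (auto simp: fundamental_for_theta_eq_iff)
  have det: "\<forall>\<^sub>\<approx>z\<in>- {0}. det (A z) \<noteq> 0" "\<forall>\<^sub>\<approx>z\<in>- {0}. det (M z) \<noteq> 0"
    using A M by (auto simp: nonsingular_meromorphic_matrix_iff)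
  have "nonsingular_meromorphic_matrix N"
    unfolding N_def
    by (intro nonsingular_meromorphic_matrix_mult nonsingular_meromorphic_matrix_inv
        nonsingular_meromorphic_matrix_scale M assms(2))
  moreover have "\<forall>\<^sub>\<approx>z\<in>- {0}. transpose (M (p * z)) = transpose (N z) ** transpose (M z)"
    using det(2)
  proof eventually_elim
    case (elim z)
    have "M (p * z) = M z ** N z"
      by (simp add: N_def matrix_mul_assoc matrix_inv_right elim)
    thus ?case
      by (simp add: matrix_transpose_mul)
  qed
  moreover have "\<forall>\<^sub>\<approx>z\<in>- {0}. transpose (N (q * z)) = mat (\<mu> z) ** transpose (N z)"
    using det fund shift eventually_cosparse_punctured_scale [OF fund assms(2)]
  proof eventually_elim
    case (elim z)
    \<comment> \<open>Here \<open>M (p * (q * z))\<close> is read as \<open>M (q * (p * z))\<close>,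
      so \<open>fund\<close> at \<open>p * z\<close> followed by \<open>shift\<close>
      applies.\<close>
    have "N (q * z) = matrix_inv (A z ** M z) ** (mat (\<mu> z) ** A z ** M (p * z))"
      using elim by (simp add: N_def mult.left_commute)
    also have "\<dots> = matrix_inv (M z) ** (matrix_inv (A z) ** A z) ** mat (\<mu> z) ** M (p * z)"
      using elim by (simp add: matrix_inv_mult matrix_mul_assoc mat_mult_commute [of _ "A z"])
    also have "\<dots> = N z ** mat (\<mu> z)"
      using elim by (simp add: matrix_inv_left N_def mat_mult_commute matrix_mul_assoc [symmetric])
    finally show ?case
      by (simp add: matrix_transpose_mul)
  qed
  ultimately show ?thesis
    using \<mu> M by (simp add: fundamental_for_theta_eq_iff nonsingular_meromorphic_matrix_transpose)
qed

text \<open>Inversion and transposition each reverse products, so their composite preserves the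
  order: the shift matrix stays on the left and \<open>p\<close>, \<open>q\<close> keep their roles.
  Only the scalar \<mu> is inverted.\<close>

lemma fundamental_for_theta_eq_inverse_transpose:
  fixes M :: "complex \<Rightarrow> complex^'n^'n"
  assumes "fundamental_for_theta_eq p q \<mu> A M"
  shows "fundamental_for_theta_eq p q (\<lambda>z. inverse (\<mu> z))
    (\<lambda>z. matrix_inv (transpose (A z))) (\<lambda>z. matrix_inv (transpose (M z)))"
proof -
  have \<mu>: "theta_multiplier \<mu>"
    and A: "nonsingular_meromorphic_matrix A"
    and M: "nonsingular_meromorphic_matrix M"
    and shift: "\<forall>\<^sub>\<approx>z\<in>- {0}. A (p * z) = mat (\<mu> z) ** A z"
    and fund: "\<forall>\<^sub>\<approx>z\<in>- {0}. M (q * z) = A z ** M z"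
    using assms by (auto simp: fundamental_for_theta_eq_iff)
  have det: "\<forall>\<^sub>\<approx>z\<in>- {0}. det (A z) \<noteq> 0" "\<forall>\<^sub>\<approx>z\<in>- {0}. det (M z) \<noteq> 0"
    using A M by (auto simp: nonsingular_meromorphic_matrix_iff)
  have "\<forall>\<^sub>\<approx>z\<in>- {0}. matrix_inv (transpose (A (p * z))) =
      mat (inverse (\<mu> z)) ** matrix_inv (transpose (A z))"
    using det(1) shift eventually_cosparse_nonzero
  proof eventually_elim
    case (elim z)
    have "transpose (A (p * z)) = mat (\<mu> z) ** transpose (A z)"
      using elim by (simp add: matrix_transpose_mul mat_mult_commute)
    thus ?case
      using elim theta_multiplier_nonzero [OF \<mu>] by (simp add: matrix_inv_scaled)
  qed
  moreover have "\<forall>\<^sub>\<approx>z\<in>- {0}. matrix_inv (transpose (M (q * z))) =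
      matrix_inv (transpose (A z)) ** matrix_inv (transpose (M z))"
    using det fund by eventually_elim (simp add: matrix_transpose_mul matrix_inv_mult)
  ultimately show ?thesis
    using \<mu> A M by (simp add: fundamental_for_theta_eq_iff theta_multiplier_inverse
        nonsingular_meromorphic_matrix_transpose nonsingular_meromorphic_matrix_inv)
qed

section \<open>Uniqueness of shift matrices and multipliers\<close>

lemma fundamental_for_theta_eq_shift_unique:
  assumes "fundamental_for_theta_eq p q \<mu> A M" "fundamental_for_theta_eq p q \<nu> B M"
  shows "meromorphic_matrix_eq A B"
proof -
  have "\<forall>\<^sub>\<approx>z\<in>- {0}. M (q * z) = A z ** M z" "\<forall>\<^sub>\<approx>z\<in>- {0}. M (q * z) = B z ** M z"
    "\<forall>\<^sub>\<approx>z\<in>- {0}. det (M z) \<noteq> 0"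
    using assms by (auto simp: fundamental_for_theta_eq_iff nonsingular_meromorphic_matrix_iff)
  thus ?thesis
    unfolding meromorphic_matrix_eq_def
    by eventually_elim (metis matrix_inv_right matrix_mul_assoc matrix_mul_rid)
qed

text \<open>The shift matrices agree off a sparse set at both \<open>z\<close> and
  \<open>p * z\<close>, so \<mu> and \<nu> scale the same invertible matrix to the same
  result.\<close>

lemma fundamental_for_theta_eq_multiplier_unique:
  assumes "fundamental_for_theta_eq p q \<mu> A M" "fundamental_for_theta_eq p q \<nu> B M"
    and "p \<noteq> 0" "z \<noteq> 0"
  shows "\<mu> z = \<nu> z"
proof -
  note AB = fundamental_for_theta_eq_shift_unique [OF assms(1,2),
      unfolded meromorphic_matrix_eq_def]
  have "\<forall>\<^sub>\<approx>z\<in>- {0}. A (p * z) = mat (\<mu> z) ** A z" "\<forall>\<^sub>\<approx>z\<in>- {0}. B (p * z) = mat (\<nu> z) ** B z"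
    "\<forall>\<^sub>\<approx>z\<in>- {0}. det (A z) \<noteq> 0"
    using assms by (auto simp: fundamental_for_theta_eq_iff nonsingular_meromorphic_matrix_iff)
  hence "\<forall>\<^sub>\<approx>z\<in>- {0}. \<mu> z = \<nu> z"
    using AB eventually_cosparse_punctured_scale [OF AB assms(3)]
  proof eventually_elim
    case (elim z)
    hence "mat (\<mu> z) ** A z = mat (\<nu> z) ** A z"
      by simp
    hence "mat (\<mu> z) = (mat (\<nu> z) :: complex^'a^'a)"
      by (metis elim(3) matrix_inv_right matrix_mul_assoc matrix_mul_rid)
    thus ?case
      \<comment> \<open>Compare a diagonal entry of the two scalar matrices.\<close>
      by (simp add: vec_eq_iff mat_def) metis
  qed
  thus ?thesis
    using assms theta_multiplier_eqI by (auto simp: fundamental_for_theta_eq_iff)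
qed

section \<open>Equivalences between the existence statements\<close>

lemma fundamental_for_some_iff_unique:
  "fundamental_for_some p q M \<longleftrightarrow> fundamental_for_unique p q M"
  unfolding fundamental_for_some_def fundamental_for_unique_def
  by (meson fundamental_for_theta_eq_shift_unique)

lemma fundamental_for_some_transpose_iff:
  assumes "p \<noteq> 0" "q \<noteq> 0"
  shows "fundamental_for_some p q M \<longleftrightarrow> fundamental_for_some q p (\<lambda>z. transpose (M z))"
proof
  show "fundamental_for_some q p (\<lambda>z. transpose (M z))" if "fundamental_for_some p q M"
    using that assms fundamental_for_theta_eq_transpose unfolding fundamental_for_some_def by blast
  show "fundamental_for_some p q M" if some: "fundamental_for_some q p (\<lambda>z. transpose (M z))"
  proof -
    obtain A \<mu> where "fundamental_for_theta_eq q p \<mu> A (\<lambda>z. transpose (M z))"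
      using some unfolding fundamental_for_some_def by blast
    \<comment> \<open>Transposition is an involution, so the converse is the forward direction with
      \<open>p\<close> and \<open>q\<close> exchanged.\<close>
    from fundamental_for_theta_eq_transpose [OF this assms(2,1)] show ?thesis
      unfolding fundamental_for_some_def transpose_transpose by blast
  qed
qed

text \<open>The inverse transpose undoes itself only where the determinant is nonzero, so the
  converse recovers \<open>M\<close> off a sparse set and then passes to \<open>M\<close> by
  \<open>fundamental_for_theta_eq_cong\<close>.\<close>

lemma fundamental_for_some_inverse_transpose_iff:
  assumes "nonsingular_meromorphic_matrix M" "q \<noteq> 0"
  shows "fundamental_for_some p q M \<longleftrightarrow>
    fundamental_for_some p q (\<lambda>z. matrix_inv (transpose (M z)))"
proof
  assume "fundamental_for_some p q M"
  thus "fundamental_for_some p q (\<lambda>z. matrix_inv (transpose (M z)))"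
    using fundamental_for_theta_eq_inverse_transpose unfolding fundamental_for_some_def by blast
next
  have "\<forall>\<^sub>\<approx>z\<in>- {0}. det (M z) \<noteq> 0"
    using assms by (simp add: nonsingular_meromorphic_matrix_iff)
  hence "\<forall>\<^sub>\<approx>z\<in>- {0}. matrix_inv (transpose (matrix_inv (transpose (M z)))) = M z"
    by eventually_elim (simp add: matrix_inv_transpose matrix_inv_matrix_inv)
  moreover assume "fundamental_for_some p q (\<lambda>z. matrix_inv (transpose (M z)))"
  ultimately show "fundamental_for_some p q M"
    using fundamental_for_theta_eq_inverse_transpose fundamental_for_theta_eq_cong assms
    unfolding fundamental_for_some_def by blast
qed

theorem theorem2p6:
  fixes p q :: complex and M :: "complex \<Rightarrow> complex^'n^'n"
  assumes "p \<noteq> 0" and "q \<noteq> 0" and "norm p < 1" and "norm q < 1"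
    and "range (\<lambda>k::int. p powi k) \<inter> range (\<lambda>k::int. q powi k) = {1}"
    and "nonsingular_meromorphic_matrix M"
  defines "Mt \<equiv> \<lambda>z. transpose (M z)"
    and "Mit \<equiv> \<lambda>z. matrix_inv (transpose (M z))"
    and "Mi \<equiv> \<lambda>z. matrix_inv (M z)"
  shows "(fundamental_for_some p q M \<longleftrightarrow> fundamental_for_some q p Mt) \<and>
         (fundamental_for_some p q M \<longleftrightarrow> fundamental_for_some p q Mit) \<and>
         (fundamental_for_some p q M \<longleftrightarrow> fundamental_for_some q p Mi) \<and>
         (fundamental_for_some p q M \<longleftrightarrow> fundamental_for_unique p q M) \<and>
         (fundamental_for_some p q M \<longleftrightarrow> fundamental_for_unique q p Mt) \<and>
         (fundamental_for_some p q M \<longleftrightarrow> fundamental_for_unique p q Mit) \<and>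
         (fundamental_for_some p q M \<longleftrightarrow> fundamental_for_unique q p Mi) \<and>
         (fundamental_for_some p q M \<longrightarrow>
           (\<forall>A \<mu> C \<nu> A' \<mu>' C' \<nu>'.
              fundamental_for_theta_eq p q \<mu> A M \<and>
              fundamental_for_theta_eq q p \<nu> C Mt \<and>
              fundamental_for_theta_eq p q \<mu>' A' Mit \<and>
              fundamental_for_theta_eq q p \<nu>' C' Mi \<longrightarrow>
              (\<forall>z. z \<noteq> 0 \<longrightarrow> \<nu> z = \<mu> z \<and> \<mu>' z = inverse (\<mu> z) \<and> \<nu>' z = inverse (\<mu> z))))"
proof -
  have Mt: "fundamental_for_some p q M \<longleftrightarrow> fundamental_for_some q p Mt"
    unfolding Mt_def using assms(1,2) by (rule fundamental_for_some_transpose_iff)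
  have Mit: "fundamental_for_some p q M \<longleftrightarrow> fundamental_for_some p q Mit"
    unfolding Mit_def using assms(6,2) by (rule fundamental_for_some_inverse_transpose_iff)
  \<comment> \<open>The inverse transpose of \<open>Mt\<close> is \<open>Mi\<close>; the lemma is
    applied with theta parameter \<open>q\<close> and difference parameter \<open>p\<close>.\<close>
  have "fundamental_for_some q p Mt \<longleftrightarrow> fundamental_for_some q p Mi"
    using fundamental_for_some_inverse_transpose_iff [of Mt p q] assms(1,6)
    by (simp add: Mt_def Mi_def nonsingular_meromorphic_matrix_transpose)
  with Mt have Mi: "fundamental_for_some p q M \<longleftrightarrow> fundamental_for_some q p Mi"
    by simp
  have "\<nu> z = \<mu> z \<and> \<mu>' z = inverse (\<mu> z) \<and> \<nu>' z = inverse (\<mu> z)"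
    if "fundamental_for_theta_eq p q \<mu> A M" "fundamental_for_theta_eq q p \<nu> C Mt"
      "fundamental_for_theta_eq p q \<mu>' A' Mit" "fundamental_for_theta_eq q p \<nu>' C' Mi" "z \<noteq> 0"
    for A \<mu> C \<nu> A' \<mu>' C' \<nu>' z
  proof -
    \<comment> \<open>From the equation of \<open>M\<close> alone, equations for the other three
      matrices are built with multipliers \<mu>, 1/\<mu>, 1/\<mu>. Uniqueness of multipliers then
      identifies these with the given ones.\<close>
    note eqMt = fundamental_for_theta_eq_transpose [OF that(1) assms(1,2)]
    note eqMit = fundamental_for_theta_eq_inverse_transpose [OF that(1)]
    note eqMi = fundamental_for_theta_eq_inverse_transpose [OF eqMt, unfolded transpose_transpose]
    show ?thesis
      using fundamental_for_theta_eq_multiplier_unique [OF that(2) eqMt [folded Mt_def]]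
        fundamental_for_theta_eq_multiplier_unique [OF that(3) eqMit [folded Mit_def]]
        fundamental_for_theta_eq_multiplier_unique [OF that(4) eqMi [folded Mi_def]]
        assms(1,2) that(5)
      by simp
  qed
  with Mt Mit Mi show ?thesis
    unfolding fundamental_for_some_iff_unique [symmetric] by blast
qed

end
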